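(* Let $m \geq 1$ be an integer and let $A_0,\dots,A_m,B$ be complex $m \times m$ matrices. Then for every $\ell \in \mathbb{N} = \{0,1,2,\dots\}$ it holds that $$\sum_{\sigma \in \mathfrak{S}_m,\ \tau \in C_{m+1}} \operatorname{sgn}(\sigma)\operatorname{sgn}(\tau)\operatorname{Tr}\big(A_{\tau(0)}B^{\sigma(0)}A_{\tau(1)}B^{\sigma(1)} \cdots A_{\tau(m-1)}B^{\sigma(m-1)}A_{\tau(m)}B^{\ell}\big) = 0.$$ Here $\mathfrak{S}_m$ is the symmetric group acting on $\{0,1,\dots,m-1\}$, and $C_{m+1}$ is the cyclic group acting on $\{0,1,\dots,m\}$.
   Context: $C_{m+1}$ is the group of permutations of $\{0,\dots,m\}$ generated by the cyclic shift $i \mapsto i+1 \pmod{m+1}$; $\operatorname{sgn}$ denotes the sign of a permutation (of $\{0,\dots,m-1\}$ for $\sigma$, of $\{0,\dots,m\}$ for $\tau$). $B^0$ is the identity matrix, and $\operatorname{Tr}$ is the trace. *)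

theory Defs
  imports
    "Jordan_Normal_Form.Matrix"
    "HOL-Algebra.Generated_Groups"
    "HOL-Combinatorics.Permutations"
    Complex_Main
begin

definition mat_trace :: "'a::comm_monoid_add mat \<Rightarrow> 'a" where
  "mat_trace M = (\<Sum>i<dim_row M. M $$ (i, i))"

definition perm_group :: "'a set \<Rightarrow> ('a \<Rightarrow> 'a) monoid" where
  "perm_group S = \<lparr>carrier = {p. p permutes S}, mult = (\<circ>), one = id\<rparr>"

(* As required by permutes, the shift is the identity outside {0..m}. *)
definition cyclic_shift :: "nat \<Rightarrow> nat \<Rightarrow> nat" where
  "cyclic_shift m i = (if i \<le> m then (i + 1) mod (m + 1) else i)"

(* The group C_{m+1} acting on {0..m}; note that the parameter is m, not m + 1. *)
definition cyclic_perms :: "nat \<Rightarrow> (nat \<Rightarrow> nat) set" where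
  "cyclic_perms m = generate (perm_group {0..m}) {cyclic_shift m}"

(* A (t 0) * B^(s 0) * A (t 1) * B^(s 1) * ... * A (t (m-1)) * B^(s (m-1)) * A (t m) * B^l *)
definition alternating_word ::
  "nat \<Rightarrow> (nat \<Rightarrow> 'a::semiring_1 mat) \<Rightarrow> 'a mat \<Rightarrow> (nat \<Rightarrow> nat) \<Rightarrow> (nat \<Rightarrow> nat) \<Rightarrow> nat \<Rightarrow> 'a mat" where
  "alternating_word m A B s t l =
     foldr (\<lambda>k M. A (t k) * (B ^\<^sub>m s k) * M) [0..<m] (A (t m) * (B ^\<^sub>m l))"

end

(* Write B = P T P^-1 with T upper triangular and absorb P into the A_i. The sum is continuous in
   the diagonal of T, which may therefore be taken distinct, and then B may be taken diagonal with
   entries x_0, ..., x_{m-1}. Expanding the trace over closed index walks i_0, ..., i_m and summing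
   over sigma produces the alternant det (x_{i_k}^j), k < m, which vanishes unless i_0, ..., i_{m-1} is
   a permutation of the indices, in which case it is that permutation's sign times a Vandermonde
   determinant. So the base point j = i_m of the walk is visited exactly once more, say at time p, and
   restarting the walk from that visit leaves the weight unchanged. This rotates tau by p + 1 steps
   and changes the permutation i_0, ..., i_{m-1} by the same rotation times one transposition;
   hence the terms cancel in pairs. *)
theory Submission
  imports Defs "Jordan_Normal_Form.Jordan_Normal_Form_Existence"
begin

section \<open>The cyclic group and its generator\<close>

lemma group_perm_group: "group (perm_group S)"
proof (rule groupI)
  fix p assume p: "p \<in> carrier (perm_group S)"
  then show "\<exists>q\<in>carrier (perm_group S). q \<otimes>\<^bsub>perm_group S\<^esub> p = \<one>\<^bsub>perm_group S\<^esub>"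
    by (intro bexI[of _ "Hilbert_Choice.inv p"])
      (auto simp: perm_group_def permutes_inv permutes_inv_o)
qed (auto simp: perm_group_def permutes_compose permutes_id o_assoc)

text \<open>Inverse of the shift on {0..m}. In a closed walk whose base point is stored at time m,
  factor k leads from the vertex at time \<open>cyclic_pred m k\<close> to the vertex at time
  k.\<close>

definition cyclic_pred :: "nat \<Rightarrow> nat \<Rightarrow> nat" where
  "cyclic_pred m k = (if k = 0 then m else k - 1)"

lemma cyclic_shift_funpow:
  "k \<le> m \<Longrightarrow> (cyclic_shift m ^^ a) k = (k + a) mod (m + 1)"
proof (induction a)
  case (Suc a)
  have "(k + a) mod (m + 1) \<le> m"
    by (metis Suc_eq_plus1 less_Suc_eq_le mod_less_divisor zero_less_Suc)
  with Suc show ?case by (simp add: cyclic_shift_def mod_Suc_eq)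
qed auto

lemma cyclic_shift_funpow_outside: "k > m \<Longrightarrow> (cyclic_shift m ^^ a) k = k"
  by (induction a) (auto simp: cyclic_shift_def)

lemma cyclic_shift_permutes: "cyclic_shift m permutes {0..m}"
proof (rule bij_imp_permutes)
  show "bij_betw (cyclic_shift m) {0..m} {0..m}"
    by (rule bij_betw_byWitness[where f' = "cyclic_pred m"])
      (auto simp: cyclic_shift_def cyclic_pred_def mod_Suc)
qed (auto simp: cyclic_shift_def)

lemma cyclic_shift_funpow_permutes: "(cyclic_shift m ^^ a) permutes {0..m}"
proof (induction a)
  case (Suc a)
  show ?case unfolding funpow.simps by (rule permutes_compose[OF Suc.IH cyclic_shift_permutes])
next
  case 0
  show ?case by (simp only: funpow.simps permutes_id)
qed

lemma cyclic_perms_permutes: "t \<in> cyclic_perms m \<Longrightarrow> t permutes {0..m}"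
  using group.generate_in_carrier[OF group_perm_group, of "{cyclic_shift m}" "{0..m}" t]
    cyclic_shift_permutes[of m]
  by (auto simp: cyclic_perms_def perm_group_def)

text \<open>Keeps the rotated \<tau> inside the cyclic group when a walk is restarted.\<close>

lemma cyclic_perms_comp_funpow:
  "t \<in> cyclic_perms m \<Longrightarrow> t \<circ> (cyclic_shift m ^^ a) \<in> cyclic_perms m"
proof (induction a)
  case (Suc a)
  have "cyclic_shift m \<in> cyclic_perms m"
    unfolding cyclic_perms_def by (rule generate.incl) simp
  from generate.eng[OF Suc.IH[OF Suc.prems, unfolded cyclic_perms_def] this[unfolded cyclic_perms_def]]
  show ?case
    by (simp add: cyclic_perms_def perm_group_def funpow_swap1 o_def)
qed auto

text \<open>\<open>cyclic_pred\<close> inverts the shift on {0..m}, so it commutes with the powers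
  of the shift. Thus consecutive vertices of a closed walk stay consecutive under rotation.\<close>

lemma cyclic_pred_funpow:
  assumes "k \<le> m"
  shows "cyclic_pred m ((cyclic_shift m ^^ a) k) = (cyclic_shift m ^^ a) (cyclic_pred m k)"
proof -
  have le: "cyclic_pred m k \<le> m" using assms by (auto simp: cyclic_pred_def)
  have eq: "cyclic_shift m (cyclic_pred m k) = k"
    using assms by (auto simp: cyclic_shift_def cyclic_pred_def)
  have le': "(cyclic_shift m ^^ a) (cyclic_pred m k) \<le> m"
    using permutes_in_image[OF cyclic_shift_funpow_permutes[of a m], of "cyclic_pred m k"] le by simp
  have "(cyclic_shift m ^^ a) k = cyclic_shift m ((cyclic_shift m ^^ a) (cyclic_pred m k))"
    by (subst eq[symmetric]) (simp add: funpow_swap1)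
  then show ?thesis using le' by (auto simp: cyclic_shift_def cyclic_pred_def mod_Suc)
qed

section \<open>Restarting a closed walk\<close>

text \<open>
  Exchanges the blocks before and after position \<open>p\<close> of the sequence \<open>0, \<dots>, m - 1\<close>. Written as a
  transposition after a rotation of \<open>{0..m}\<close>, its sign needs no parity computation, since the
  rotation also acts on \<open>\<tau>\<close>.
\<close>

definition block_swap :: "nat \<Rightarrow> nat \<Rightarrow> nat \<Rightarrow> nat" where
  "block_swap m p = transpose p m \<circ> (cyclic_shift m ^^ Suc p)"

text \<open>The rotation sends m - 1 - p to m and m to p, and the transposition exchanges these two
  values. So m becomes a fixed point, and the values at 0, ..., m - 1 are p + 1, ..., m - 1, p, 0,
  ..., p - 1.\<close>

lemma block_swap_apply:
  assumes "p < m"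
  shows "block_swap m p k = (if k < m - 1 - p then k + p + 1 else if k = m - 1 - p then p
    else if k < m then k + p - m else k)"
proof -
  consider "k < m - 1 - p" | "k = m - 1 - p" | "m - 1 - p < k" "k < m" | "k = m" | "k > m"
    by linarith
  then show ?thesis
  proof cases
    case 3
    then have "(k + Suc p) mod (m + 1) = k + p - m"
      using assms by (subst mod_if) auto
    with 3 assms show ?thesis
      by (auto simp: block_swap_def cyclic_shift_funpow transpose_def simp del: funpow.simps)
  next
    case 4
    then have "(k + Suc p) mod (m + 1) = p"
      using assms by (subst mod_if) auto
    with 4 assms show ?thesis
      by (auto simp: block_swap_def cyclic_shift_funpow transpose_def simp del: funpow.simps)
  qed (use assms in \<open>auto simp: block_swap_def cyclic_shift_funpow cyclic_shift_funpow_outside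
          transpose_def simp del: funpow.simps\<close>)
qed

lemma block_swap_permutes:
  assumes "p < m"
  shows "block_swap m p permutes {0..<m}"
proof (rule permutes_superset)
  show "block_swap m p permutes {0..m}"
    unfolding block_swap_def using assms
    by (intro permutes_compose cyclic_shift_funpow_permutes permutes_swap_id) auto
qed (use assms in \<open>auto simp: block_swap_apply\<close>)

lemma sign_block_swap:
  assumes "p < m"
  shows "sign (block_swap m p) = - sign (cyclic_shift m ^^ Suc p)"
proof -
  have "permutation (cyclic_shift m ^^ Suc p)"
    using cyclic_shift_funpow_permutes permutes_imp_permutation by blast
  then show ?thesis
    unfolding block_swap_def using assms
    by (simp add: sign_compose permutation_swap_id sign_swap_id del: funpow.simps)
qed

text \<open>Restarting moves the second visit of the base point from time p to time m - 1 - p, so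
  undoing it means swapping blocks at m - 1 - p.\<close>

lemma block_swap_inverse:
  assumes "p < m"
  shows "block_swap m p \<circ> block_swap m (m - 1 - p) = id"
  using assms by (auto simp: fun_eq_iff block_swap_apply)

text \<open>The rotations by p + 1 and m - p steps add up to a full turn of m + 1.\<close>

lemma cyclic_shift_funpow_inverse:
  assumes "p < m"
  shows "(cyclic_shift m ^^ Suc p) \<circ> (cyclic_shift m ^^ Suc (m - 1 - p)) = id"
proof
  fix k
  have "(cyclic_shift m ^^ (Suc p + Suc (m - 1 - p))) k = k"
    using assms mod_add_self2[of k "Suc m"]
    by (cases "k \<le> m") (auto simp: cyclic_shift_funpow cyclic_shift_funpow_outside simp del: funpow.simps mod_add_self2)
  then show "((cyclic_shift m ^^ Suc p) \<circ> (cyclic_shift m ^^ Suc (m - 1 - p))) k = id k"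
    by (simp only: funpow_add o_apply id_apply)
qed

text \<open>
  The walk \<open>\<pi>(m := j)\<close> visits \<open>j\<close> exactly twice, at \<open>m\<close> and at \<open>p = \<pi>\<^sup>-\<^sup>1 j\<close>; the sign-reversing
  involution \<open>\<Phi>\<close> restarts it at the other visit.
\<close>

lemma closed_walk_sum_eq_0:
  fixes F :: "nat \<Rightarrow> nat \<Rightarrow> nat \<Rightarrow> 'a::{idom,ring_char_0}"
  assumes j: "j < m"
  shows "(\<Sum>\<tau>\<in>cyclic_perms m. \<Sum>\<pi> | \<pi> permutes {0..<m}. of_int (sign \<tau>) * of_int (sign \<pi>) *
           (\<Prod>k\<in>{0..m}. F (\<tau> k) ((\<pi>(m := j)) (cyclic_pred m k)) ((\<pi>(m := j)) k))) = 0"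
proof -
  define P where "P = {\<pi>. \<pi> permutes {0..<m}}"
  define g where "g = (\<lambda>(\<tau>, \<pi>). of_int (sign \<tau>) * of_int (sign \<pi>) *
           (\<Prod>k\<in>{0..m}. F (\<tau> k) ((\<pi>(m := j)) (cyclic_pred m k)) ((\<pi>(m := j)) k)))"
  define \<Phi> where "\<Phi> = (\<lambda>(\<tau>::nat \<Rightarrow> nat, \<pi>::nat \<Rightarrow> nat). let p = Hilbert_Choice.inv \<pi> j in
     (\<tau> \<circ> (cyclic_shift m ^^ Suc p), \<pi> \<circ> block_swap m p))"
  have *: "\<Phi> x \<in> cyclic_perms m \<times> P \<and> \<Phi> (\<Phi> x) = x \<and> g (\<Phi> x) = - g x"
    if x: "x \<in> cyclic_perms m \<times> P" for x
  proof -
    obtain \<tau> \<pi> where x_eq: "x = (\<tau>, \<pi>)" by force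
    with x have \<tau>: "\<tau> \<in> cyclic_perms m" and \<pi>: "\<pi> permutes {0..<m}" by (auto simp: P_def)
    define p where "p = Hilbert_Choice.inv \<pi> j"
    have p: "p < m" using j permutes_in_image[OF permutes_inv[OF \<pi>], of j] by (simp add: p_def)
    have \<pi>p: "\<pi> p = j" by (simp add: p_def permutes_inverses(1)[OF \<pi>])
    define r where "r = cyclic_shift m ^^ Suc p"
    define \<pi>' where "\<pi>' = \<pi> \<circ> block_swap m p"
    have \<Phi>x: "\<Phi> x = (\<tau> \<circ> r, \<pi>')" by (simp add: \<Phi>_def x_eq r_def p_def \<pi>'_def Let_def)
    have \<pi>': "\<pi>' permutes {0..<m}"
      unfolding \<pi>'_def by (intro permutes_compose block_swap_permutes \<pi> p)
    \<comment> \<open>The restarted walk has its second visit at m - 1 - p, so \<Phi> acts on it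
      with this value in place of p, and the two inverse lemmas make \<Phi> an involution.\<close>
    have "\<pi>' (m - 1 - p) = j" using p \<pi>p by (simp add: \<pi>'_def block_swap_apply)
    then have p': "Hilbert_Choice.inv \<pi>' j = m - 1 - p"
      using permutes_inverses(2)[OF \<pi>'] by metis
    have "\<Phi> (\<Phi> x) = (\<tau> \<circ> (r \<circ> (cyclic_shift m ^^ Suc (m - 1 - p))),
        \<pi> \<circ> (block_swap m p \<circ> block_swap m (m - 1 - p)))"
      unfolding \<Phi>x unfolding \<Phi>_def Let_def prod.case p' unfolding \<pi>'_def r_def o_assoc ..
    then have inv: "\<Phi> (\<Phi> x) = x"
      unfolding r_def cyclic_shift_funpow_inverse[OF p] block_swap_inverse[OF p] by (simp add: x_eq)
    have rper: "r permutes {0..m}" unfolding r_def by (rule cyclic_shift_funpow_permutes)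
    have perms: "permutation r" "permutation \<tau>" "permutation \<pi>" "permutation (block_swap m p)"
      using rper cyclic_perms_permutes[OF \<tau>] \<pi> block_swap_permutes[OF p]
      by (auto intro: permutes_imp_permutation[rotated])
    have rm: "r m = p" using p
      unfolding r_def by (simp add: cyclic_shift_funpow mod_if del: funpow.simps)
    \<comment> \<open>The walk of \<pi>' is that of \<pi> rotated by r. The transposition in
      \<open>block_swap\<close> is invisible here: it exchanges p and m, the two times at which the
      walk is at j.\<close>
    have u: "(\<pi>'(m := j)) k = (\<pi>(m := j)) (r k)" if "k \<le> m" for k
    proof (cases "k = m")
      case True
      with rm \<pi>p p show ?thesis by simp
    next
      case False
      then have "r k \<noteq> p"
        using rm injD[OF permutes_inj[OF rper]] by metis
      then show ?thesis using False \<pi>p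
        by (auto simp: \<pi>'_def block_swap_def r_def[symmetric] transpose_def simp del: funpow.simps)
    qed
    have "(\<Prod>k\<in>{0..m}. F ((\<tau> \<circ> r) k) ((\<pi>'(m := j)) (cyclic_pred m k)) ((\<pi>'(m := j)) k)) =
        (\<Prod>k\<in>{0..m}. F (\<tau> (r k)) ((\<pi>(m := j)) (cyclic_pred m (r k))) ((\<pi>(m := j)) (r k)))"
    proof (rule prod.cong[OF refl])
      fix k assume "k \<in> {0..m}"
      then have k: "k \<le> m" and k': "cyclic_pred m k \<le> m" by (auto simp: cyclic_pred_def)
      show "F ((\<tau> \<circ> r) k) ((\<pi>'(m := j)) (cyclic_pred m k)) ((\<pi>'(m := j)) k) =
        F (\<tau> (r k)) ((\<pi>(m := j)) (cyclic_pred m (r k))) ((\<pi>(m := j)) (r k))"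
        unfolding u[OF k] u[OF k'] using cyclic_pred_funpow[OF k, of "Suc p"] by (simp add: r_def del: funpow.simps)
    qed
    \<comment> \<open>The weight is a product over all factors of the closed walk, hence independent
      of the starting point.\<close>
    also have "\<dots> = (\<Prod>k\<in>{0..m}. F (\<tau> k) ((\<pi>(m := j)) (cyclic_pred m k)) ((\<pi>(m := j)) k))"
      by (rule prod.permute[OF rper, symmetric, unfolded o_def])
    finally have W: "(\<Prod>k\<in>{0..m}. F ((\<tau> \<circ> r) k) ((\<pi>'(m := j)) (cyclic_pred m k)) ((\<pi>'(m := j)) k)) = \<dots>" .
    \<comment> \<open>The sign of r enters once through \<tau> and once through
      \<open>block_swap\<close>, so it squares to 1; only the sign of the transposition is
      left.\<close>
    have "sign (\<tau> \<circ> r) * sign \<pi>' = - (sign \<tau> * sign \<pi> * (sign r * sign r))"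
      unfolding \<pi>'_def using perms sign_block_swap[OF p]
      by (simp add: sign_compose r_def del: funpow.simps sign_idempotent sign_left_idempotent)
    then have sgn: "(of_int (sign (\<tau> \<circ> r)) * of_int (sign \<pi>') :: 'a) = - (of_int (sign \<tau>) * of_int (sign \<pi>))"
      by (metis mult.right_neutral of_int_minus of_int_mult sign_idempotent)
    have "g (\<tau> \<circ> r, \<pi>') = - g (\<tau>, \<pi>)"
      unfolding g_def prod.case W sgn by (rule mult_minus_left)
    then have "g (\<Phi> x) = - g x"
      by (simp only: \<Phi>x) (simp only: x_eq)
    moreover have "\<Phi> x \<in> cyclic_perms m \<times> P"
      unfolding \<Phi>x using \<pi>' cyclic_perms_comp_funpow[OF \<tau>, of "Suc p"]
      by (simp add: P_def r_def del: funpow.simps)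
    ultimately show ?thesis using inv by blast
  qed
  \<comment> \<open>As \<Phi> reverses signs, the sum equals its own negative; it vanishes because 2
    is nonzero in a domain of characteristic 0.\<close>
  have "sum g (cyclic_perms m \<times> P) = (\<Sum>x\<in>cyclic_perms m \<times> P. - g x)"
    by (rule sum.reindex_bij_witness[where i = \<Phi> and j = \<Phi>]) (use * in fastforce)+
  then have "2 * sum g (cyclic_perms m \<times> P) = 0"
    by (simp add: sum_negf)
  then show ?thesis
    by (simp add: sum.cartesian_product g_def P_def)
qed

section \<open>Matrix products as sums over walks\<close>

lemma sum_PiE_insert:
  assumes "i \<notin> I"
  shows "(\<Sum>f\<in>PiE (insert i I) T. h f) = (\<Sum>f\<in>PiE I T. \<Sum>q\<in>T i. h (f(i := q)))"
proof -
  have "(\<Sum>f\<in>PiE (insert i I) T. h f) = (\<Sum>(q, f)\<in>T i \<times> PiE I T. h (f(i := q)))"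
    unfolding PiE_insert_eq using inj_combinator[OF assms, of T]
    by (subst sum.reindex) (auto simp: case_prod_unfold o_def)
  also have "\<dots> = (\<Sum>q\<in>T i. \<Sum>f\<in>PiE I T. h (f(i := q)))"
    by (simp add: sum.cartesian_product)
  also have "\<dots> = (\<Sum>f\<in>PiE I T. \<Sum>q\<in>T i. h (f(i := q)))"
    by (rule sum.swap)
  finally show ?thesis .
qed

lemma foldr_mult_carrier:
  assumes "\<And>k. k \<in> set ks \<Longrightarrow> C k \<in> carrier_mat d d" and "N \<in> carrier_mat d d"
  shows "foldr (\<lambda>k M. C k * M) ks N \<in> carrier_mat d d"
  using assms by (induction ks) (auto intro!: mult_carrier_mat[of _ d d])

text \<open>Path expansion of a product, \<open>f k\<close> being the vertex reached after factor k.
  The tail N is arbitrary in the induction so that it can absorb the last factor \<open>C n\<close>,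
  whose summation index q becomes the new value of f at n.\<close>

lemma foldr_mult_entry:
  fixes C :: "nat \<Rightarrow> 'a::comm_semiring_1 mat"
  assumes "\<And>k. k < n \<Longrightarrow> C k \<in> carrier_mat d d" and "N \<in> carrier_mat d d"
    and "i < d" and "j < d"
  shows "foldr (\<lambda>k M. C k * M) [0..<n] N $$ (i, j) =
    (\<Sum>f\<in>PiE {0..<n} (\<lambda>_. {0..<d}).
      (\<Prod>k\<in>{0..<n}. C k $$ (if k = 0 then i else f (k - 1), f k)) *
      N $$ (if n = 0 then i else f (n - 1), j))"
  using assms
proof (induction n arbitrary: N)
  case (Suc n)
  let ?p = "\<lambda>f. if n = 0 then i else f (n - 1)"
  have Cn: "C n \<in> carrier_mat d d" using Suc.prems by simp
  then have CN: "C n * N \<in> carrier_mat d d" using Suc.prems by (intro mult_carrier_mat)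
  have entry: "(C n * N) $$ (p, j) = (\<Sum>q\<in>{0..<d}. C n $$ (p, q) * N $$ (q, j))" if "p < d" for p
    using that \<open>j < d\<close> carrier_matD[OF Cn] carrier_matD[OF \<open>N \<in> carrier_mat d d\<close>]
    by (simp add: scalar_prod_def)
  have p: "?p f < d" if "f \<in> PiE {0..<n} (\<lambda>_. {0..<d})" for f
    using that Suc.prems by (auto simp: PiE_iff)
  have "foldr (\<lambda>k M. C k * M) [0..<Suc n] N $$ (i, j) =
      (\<Sum>f\<in>PiE {0..<n} (\<lambda>_. {0..<d}).
        (\<Prod>k\<in>{0..<n}. C k $$ (if k = 0 then i else f (k - 1), f k)) * (C n * N) $$ (?p f, j))"
    using Suc.IH[OF _ CN] Suc.prems by simp
  also have "\<dots> = (\<Sum>f\<in>PiE {0..<n} (\<lambda>_. {0..<d}). \<Sum>q\<in>{0..<d}.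
        (\<Prod>k\<in>{0..<n}. C k $$ (if k = 0 then i else f (k - 1), f k)) *
        (C n $$ (?p f, q) * N $$ (q, j)))"
    using Suc.prems Cn p
    by (intro sum.cong refl) (simp only: entry[OF p] sum_distrib_left)
  also have "\<dots> = (\<Sum>f\<in>PiE {0..<n} (\<lambda>_. {0..<d}). \<Sum>q\<in>{0..<d}.
        (\<Prod>k\<in>{0..<Suc n}. C k $$ (if k = 0 then i else (f(n := q)) (k - 1), (f(n := q)) k)) *
        N $$ ((f(n := q)) n, j))"
  proof (intro sum.cong refl)
    fix f q
    have "(\<Prod>k\<in>{0..<n}. C k $$ (if k = 0 then i else (f(n := q)) (k - 1), (f(n := q)) k)) =
        (\<Prod>k\<in>{0..<n}. C k $$ (if k = 0 then i else f (k - 1), f k))"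
      by (intro prod.cong refl) auto
    then show "(\<Prod>k\<in>{0..<n}. C k $$ (if k = 0 then i else f (k - 1), f k)) *
        (C n $$ (?p f, q) * N $$ (q, j)) =
        (\<Prod>k\<in>{0..<Suc n}. C k $$ (if k = 0 then i else (f(n := q)) (k - 1), (f(n := q)) k)) *
        N $$ ((f(n := q)) n, j)"
      by (cases n) (simp_all add: mult.assoc)
  qed
  also have "\<dots> = (\<Sum>f\<in>PiE (insert n {0..<n}) (\<lambda>_. {0..<d}).
        (\<Prod>k\<in>{0..<Suc n}. C k $$ (if k = 0 then i else f (k - 1), f k)) * N $$ (f n, j))"
    by (subst sum_PiE_insert) simp_all
  finally show ?case by (simp add: atLeast0_lessThan_Suc)
qed simp

lemma mat_diag_pow: "mat_diag n x ^\<^sub>m k = mat_diag n (\<lambda>i. x i ^ k)"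
  by (induction k) (simp_all add: carrier_matD(1)[OF mat_diag_dim] power_Suc2 del: power_Suc)

text \<open>A power of a diagonal matrix only scales columns, so factor k contributes an entry of
  \<open>A (t k)\<close> times \<open>x (f k) ^ s k\<close>. Setting f at m to the base point j
  closes the walk and lets the last factor join the product. The part from A is free of s, which
  prepares the sum over s.\<close>

lemma alternating_word_diag_trace:
  fixes A :: "nat \<Rightarrow> 'a::comm_semiring_1 mat"
  assumes m: "m \<ge> 1" and A: "\<And>i. i \<le> m \<Longrightarrow> A i \<in> carrier_mat m m"
    and t: "\<And>k. k \<le> m \<Longrightarrow> t k \<le> m"
  shows "mat_trace (alternating_word m A (mat_diag m x) s t l) =
    (\<Sum>j<m. \<Sum>f\<in>PiE {0..<m} (\<lambda>_. {0..<m}). x j ^ l *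
      (\<Prod>k\<in>{0..m}. A (t k) $$ ((f(m := j)) (cyclic_pred m k), (f(m := j)) k)) *
      (\<Prod>k\<in>{0..<m}. x (f k) ^ s k))"
proof -
  define C where "C = (\<lambda>k. A (t k) * (mat_diag m x ^\<^sub>m s k))"
  define N where "N = A (t m) * (mat_diag m x ^\<^sub>m l)"
  have C: "C k \<in> carrier_mat m m" if "k < m" for k
    using A t that unfolding C_def by (intro mult_carrier_mat[of _ _ m] pow_carrier_mat) auto
  have N: "N \<in> carrier_mat m m"
    using A t unfolding N_def by (intro mult_carrier_mat[of _ _ m] pow_carrier_mat) auto
  have C_entry: "C k $$ (p, q) = A (t k) $$ (p, q) * x q ^ s k" if "k < m" "p < m" "q < m" for k p q
    using A[OF t, of k] that unfolding C_def mat_diag_pow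
    by (subst mat_diag_mult_right[of _ m]) auto
  have N_entry: "N $$ (p, q) = A (t m) $$ (p, q) * x q ^ l" if "p < m" "q < m" for p q
    using A[OF t, of m] that unfolding N_def mat_diag_pow
    by (subst mat_diag_mult_right[of _ m]) auto
  have word: "alternating_word m A (mat_diag m x) s t l = foldr (\<lambda>k M. C k * M) [0..<m] N"
    by (simp add: alternating_word_def C_def N_def)
  have "dim_row (foldr (\<lambda>k M. C k * M) [0..<m] N) = m"
    using foldr_mult_carrier[of "[0..<m]" C m N] C N by auto
  then have "mat_trace (alternating_word m A (mat_diag m x) s t l) =
      (\<Sum>j<m. foldr (\<lambda>k M. C k * M) [0..<m] N $$ (j, j))"
    by (simp add: mat_trace_def word)
  also have "\<dots> = (\<Sum>j<m. \<Sum>f\<in>PiE {0..<m} (\<lambda>_. {0..<m}). x j ^ l *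
      (\<Prod>k\<in>{0..m}. A (t k) $$ ((f(m := j)) (cyclic_pred m k), (f(m := j)) k)) *
      (\<Prod>k\<in>{0..<m}. x (f k) ^ s k))"
  proof (intro sum.cong refl)
    fix j assume "j \<in> {..<m}"
    then have j: "j < m" by simp
    have entry: "foldr (\<lambda>k M. C k * M) [0..<m] N $$ (j, j) =
      (\<Sum>f\<in>PiE {0..<m} (\<lambda>_. {0..<m}).
        (\<Prod>k\<in>{0..<m}. C k $$ (if k = 0 then j else f (k - 1), f k)) *
        N $$ (if m = 0 then j else f (m - 1), j))"
      by (rule foldr_mult_entry) (use C N j in auto)
    show "foldr (\<lambda>k M. C k * M) [0..<m] N $$ (j, j) =
      (\<Sum>f\<in>PiE {0..<m} (\<lambda>_. {0..<m}). x j ^ l *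
      (\<Prod>k\<in>{0..m}. A (t k) $$ ((f(m := j)) (cyclic_pred m k), (f(m := j)) k)) *
      (\<Prod>k\<in>{0..<m}. x (f k) ^ s k))"
      unfolding entry
    proof (intro sum.cong refl)
      fix f assume "f \<in> PiE {0..<m} (\<lambda>_. {0..<m})"
      then have f: "f k < m" if "k < m" for k using that by (auto simp: PiE_iff)
      have "(\<Prod>k\<in>{0..<m}. C k $$ (if k = 0 then j else f (k - 1), f k)) =
        (\<Prod>k\<in>{0..<m}. A (t k) $$ ((f(m := j)) (cyclic_pred m k), (f(m := j)) k) * x (f k) ^ s k)"
        by (intro prod.cong refl) (use f j in \<open>auto simp: C_entry cyclic_pred_def\<close>)
      moreover have "N $$ (if m = 0 then j else f (m - 1), j) =
          A (t m) $$ ((f(m := j)) (cyclic_pred m m), (f(m := j)) m) * x j ^ l"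
        using m f j by (cases m) (simp_all add: N_entry cyclic_pred_def)
      moreover have "{0..m} = insert m {0..<m}" by auto
      ultimately show "(\<Prod>k\<in>{0..<m}. C k $$ (if k = 0 then j else f (k - 1), f k)) *
          N $$ (if m = 0 then j else f (m - 1), j) = x j ^ l *
          (\<Prod>k\<in>{0..m}. A (t k) $$ ((f(m := j)) (cyclic_pred m k), (f(m := j)) k)) *
          (\<Prod>k\<in>{0..<m}. x (f k) ^ s k)"
        by (simp add: prod.distrib mult_ac)
    qed
  qed
  finally show ?thesis .
qed

section \<open>Alternants and the case of diagonal B\<close>

text \<open>The sum over \<sigma> is the Leibniz expansion of an alternant whose row k is built from
  \<open>x (f k)\<close>. Equal rows make it 0, so only injective f remain; these are permutations,
  and reordering the rows costs their sign. The hypothesis on G lets it pass from an extensional f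
  to the permutation that agrees with it below m.\<close>

lemma sum_functions_alternant:
  fixes x :: "nat \<Rightarrow> 'a::comm_ring_1"
  assumes G: "\<And>f g. (\<And>k. k < m \<Longrightarrow> f k = g k) \<Longrightarrow> G f = G g"
  shows "(\<Sum>f\<in>PiE {0..<m} (\<lambda>_. {0..<m}).
      G f * (\<Sum>\<sigma> | \<sigma> permutes {0..<m}. of_int (sign \<sigma>) * (\<Prod>k\<in>{0..<m}. x (f k) ^ \<sigma> k))) =
    det (mat m m (\<lambda>(i, j). x i ^ j)) * (\<Sum>\<pi> | \<pi> permutes {0..<m}. of_int (sign \<pi>) * G \<pi>)"
proof -
  define V where "V = mat m m (\<lambda>(i, j). x i ^ j)"
  define E where "E = PiE {0..<m} (\<lambda>_. {0..<m})"
  define D where "D = (\<lambda>f. det (mat m m (\<lambda>(i, j). x (f i) ^ j)))"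
  have D: "(\<Sum>\<sigma> | \<sigma> permutes {0..<m}. of_int (sign \<sigma>) * (\<Prod>k\<in>{0..<m}. x (f k) ^ \<sigma> k)) = D f" for f
    unfolding D_def by (subst det_def'[of _ m]) (auto intro!: sum.cong prod.cong)
  have D_perm: "D \<pi> = of_int (sign \<pi>) * det V" if "\<pi> permutes {0..<m}" for \<pi>
  proof -
    have "mat m m (\<lambda>(i, j). x (\<pi> i) ^ j) = mat m m (\<lambda>(i, j). V $$ (\<pi> i, j))"
      using permutes_in_image[OF that] by (intro cong_mat) (auto simp: V_def)
    then show ?thesis using det_permute_rows[OF _ that, of V] by (simp add: D_def V_def)
  qed
  have D_cong: "D f = D g" if "\<And>k. k < m \<Longrightarrow> f k = g k" for f g
    unfolding D_def by (rule arg_cong[of _ _ det], rule cong_mat) (use that in auto)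
  have D_0: "D f = 0" if "\<not> inj_on f {0..<m}" for f
  proof -
    from that obtain i j where "i < m" "j < m" "i \<noteq> j" "f i = f j" by (auto simp: inj_on_def)
    then show ?thesis unfolding D_def
      by (intro det_identical_rows[of _ m i j]) (auto intro!: eq_vecI)
  qed
  have "(\<Sum>f\<in>E. G f * D f) = (\<Sum>f\<in>{f\<in>E. inj_on f {0..<m}}. G f * D f)"
    by (rule sum.mono_neutral_right) (auto simp: D_0 E_def intro: finite_PiE)
  \<comment> \<open>Injective self-maps of {0..<m} are surjective, and extension by the identity is
    inverse to restriction.\<close>
  also have "\<dots> = (\<Sum>\<pi> | \<pi> permutes {0..<m}. G \<pi> * D \<pi>)"
  proof (rule sum.reindex_bij_witness[where i = "\<lambda>\<pi>. restrict \<pi> {0..<m}"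
        and j = "\<lambda>f k. if k < m then f k else k"], goal_cases)
    case (1 f)
    then show ?case by (auto simp: fun_eq_iff E_def PiE_def extensional_def)
  next
    case (2 f)
    then have "f ` {0..<m} = {0..<m}"
      by (intro endo_inj_surj) (auto simp: E_def)
    with 2 have "bij_betw f {0..<m} {0..<m}"
      by (simp add: bij_betw_def)
    then have "bij_betw (\<lambda>k. if k < m then f k else k) {0..<m} {0..<m}"
      by (rule bij_betw_cong[THEN iffD1, rotated]) auto
    then have "(\<lambda>k. if k < m then f k else k) permutes {0..<m}"
      by (rule bij_imp_permutes) auto
    then show ?case by simp
  next
    case (3 \<pi>)
    then show ?case by (auto simp: fun_eq_iff permutes_not_in)
  next
    case (4 \<pi>)
    then have "\<pi> permutes {0..<m}" by simp
    from permutes_in_image[OF this] permutes_inj_on[OF this] show ?case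
      by (auto simp: E_def inj_on_def)
  next
    case (5 f)
    show ?case by (intro arg_cong2[of _ _ _ _ "(*)"] G D_cong) auto
  qed
  also have "\<dots> = (\<Sum>\<pi> | \<pi> permutes {0..<m}. det V * (of_int (sign \<pi>) * G \<pi>))"
    by (rule sum.cong) (auto simp: D_perm mult_ac)
  finally show ?thesis by (simp add: D E_def V_def sum_distrib_left)
qed

text \<open>Names the left side of the theorem so that B can be replaced in turn by a triangular, a
  perturbed and a diagonal matrix.\<close>

definition alternating_trace_sum :: "nat \<Rightarrow> (nat \<Rightarrow> 'a::comm_ring_1 mat) \<Rightarrow> 'a mat \<Rightarrow> nat \<Rightarrow> 'a" where
  "alternating_trace_sum m A B l = (\<Sum>\<sigma> | \<sigma> permutes {0..<m}. \<Sum>\<tau>\<in>cyclic_perms m.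
     of_int (sign \<sigma>) * of_int (sign \<tau>) * mat_trace (alternating_word m A B \<sigma> \<tau> l))"

lemma alternating_trace_sum_diag:
  fixes A :: "nat \<Rightarrow> 'a::{idom,ring_char_0} mat"
  assumes m: "m \<ge> 1" and A: "\<And>i. i \<le> m \<Longrightarrow> A i \<in> carrier_mat m m"
  shows "alternating_trace_sum m A (mat_diag m x) l = 0"
proof -
  define P where "P = {\<sigma>. \<sigma> permutes {0..<m}}"
  define E where "E = PiE {0..<m} (\<lambda>_. {0..<m})"
  define W where "W = (\<lambda>\<tau> j f. \<Prod>k\<in>{0..m}. A (\<tau> k) $$ ((f(m := j)) (cyclic_pred m k), (f(m := j)) k))"
  have W_cong: "W \<tau> j f = W \<tau> j g" if "\<And>k. k < m \<Longrightarrow> f k = g k" for \<tau> j f g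
    unfolding W_def by (intro prod.cong refl) (use that in \<open>auto simp: cyclic_pred_def\<close>)
  have "alternating_trace_sum m A (mat_diag m x) l = (\<Sum>\<sigma>\<in>P. \<Sum>\<tau>\<in>cyclic_perms m. \<Sum>j<m. \<Sum>f\<in>E.
      of_int (sign \<tau>) * x j ^ l * (W \<tau> j f * (of_int (sign \<sigma>) * (\<Prod>k\<in>{0..<m}. x (f k) ^ \<sigma> k))))"
    unfolding alternating_trace_sum_def P_def[symmetric]
  proof (intro sum.cong refl)
    fix \<sigma> \<tau> assume "\<tau> \<in> cyclic_perms m"
    then have "\<tau> k \<le> m" if "k \<le> m" for k
      using permutes_in_image[OF cyclic_perms_permutes, of \<tau> m k] that by simp
    then show "of_int (sign \<sigma>) * of_int (sign \<tau>) * mat_trace (alternating_word m A (mat_diag m x) \<sigma> \<tau> l) =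
      (\<Sum>j<m. \<Sum>f\<in>E. of_int (sign \<tau>) * x j ^ l *
        (W \<tau> j f * (of_int (sign \<sigma>) * (\<Prod>k\<in>{0..<m}. x (f k) ^ \<sigma> k))))"
      by (subst alternating_word_diag_trace[OF m A])
        (auto simp: sum_distrib_left W_def E_def mult_ac intro!: sum.cong)
  qed
  \<comment> \<open>The sum over \<sigma> goes innermost: for a fixed walk and fixed \<tau> it is an
    alternant.\<close>
  also have "\<dots> = (\<Sum>\<tau>\<in>cyclic_perms m. \<Sum>j<m. \<Sum>f\<in>E. \<Sum>\<sigma>\<in>P.
      of_int (sign \<tau>) * x j ^ l * (W \<tau> j f * (of_int (sign \<sigma>) * (\<Prod>k\<in>{0..<m}. x (f k) ^ \<sigma> k))))"
    by (subst sum.swap, rule sum.cong[OF refl], subst sum.swap, rule sum.cong[OF refl], rule sum.swap)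
  also have "\<dots> = (\<Sum>\<tau>\<in>cyclic_perms m. \<Sum>j<m. of_int (sign \<tau>) * x j ^ l * (\<Sum>f\<in>E.
      W \<tau> j f * (\<Sum>\<sigma>\<in>P. of_int (sign \<sigma>) * (\<Prod>k\<in>{0..<m}. x (f k) ^ \<sigma> k))))"
    by (simp only: sum_distrib_left)
  also have "\<dots> = (\<Sum>\<tau>\<in>cyclic_perms m. \<Sum>j<m. of_int (sign \<tau>) * x j ^ l *
      (det (mat m m (\<lambda>(i, j). x i ^ j)) * (\<Sum>\<pi>\<in>P. of_int (sign \<pi>) * W \<tau> j \<pi>)))"
    unfolding E_def P_def by (intro sum.cong refl, subst sum_functions_alternant) (auto intro: W_cong)
  \<comment> \<open>The Vandermonde determinant and \<open>x j ^ l\<close> do not depend on \<tau>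
    and \<pi>, so for each base point j the inner double sum is the one killed by the
    involution.\<close>
  also have "\<dots> = (\<Sum>j<m. x j ^ l * det (mat m m (\<lambda>(i, j). x i ^ j)) *
      (\<Sum>\<tau>\<in>cyclic_perms m. \<Sum>\<pi>\<in>P. of_int (sign \<tau>) * of_int (sign \<pi>) * W \<tau> j \<pi>))"
    by (subst sum.swap) (simp add: sum_distrib_left mult_ac)
  also have "\<dots> = 0"
    unfolding W_def P_def
    by (intro sum.neutral ballI) (simp only: lessThan_iff mult_zero_right closed_walk_sum_eq_0[of _ m "\<lambda>i p q. A i $$ (p, q)"])
  finally show ?thesis .
qed

section \<open>Invariance under conjugation\<close>

lemma mat_trace_mult_commute:
  fixes X Y :: "'a::comm_semiring_1 mat"
  assumes X: "X \<in> carrier_mat n n" and Y: "Y \<in> carrier_mat n n"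
  shows "mat_trace (X * Y) = mat_trace (Y * X)"
proof -
  have *: "mat_trace (U * V) = (\<Sum>i<n. \<Sum>j<n. U $$ (i, j) * V $$ (j, i))"
    if "U \<in> carrier_mat n n" "V \<in> carrier_mat n n" for U V :: "'a mat"
    using that by (auto simp: mat_trace_def scalar_prod_def atLeast0LessThan intro!: sum.cong)
  show ?thesis unfolding *[OF X Y] *[OF Y X] by (subst sum.swap) (simp add: mult.commute)
qed

lemma alternating_word_carrier:
  assumes "\<And>i. i \<le> m \<Longrightarrow> A i \<in> carrier_mat m m" and "B \<in> carrier_mat m m"
    and "\<And>k. k \<le> m \<Longrightarrow> t k \<le> m"
  shows "alternating_word m A B s t l \<in> carrier_mat m m"
  unfolding alternating_word_def
  by (rule foldr_mult_carrier) (use assms in \<open>auto intro!: mult_carrier_mat[of _ m m]\<close>)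

text \<open>Here B = P D Q with Q inverse to P. Each factor built from \<open>Q * A i * P\<close>
  and a power of D is thus the conjugate of the one built from \<open>A i\<close> and B, and the
  inner P Q cancel in the product.\<close>

lemma alternating_word_similar:
  assumes A: "\<And>i. i \<le> m \<Longrightarrow> A i \<in> carrier_mat m m" and B: "B \<in> carrier_mat m m"
    and t: "\<And>k. k \<le> m \<Longrightarrow> t k \<le> m"
    and sim: "similar_mat_wit B D P Q"
  shows "alternating_word m (\<lambda>i. Q * A i * P) D s t l = Q * alternating_word m A B s t l * P"
proof -
  note simD = similar_mat_witD2[OF B sim]
  have conj: "(Q * X * P) * (Q * Y * P) = Q * (X * Y) * P"
    if X: "X \<in> carrier_mat m m" and Y: "Y \<in> carrier_mat m m" for X Y
  proof -
    note assoc = assoc_mult_mat[of _ m m _ m _ m]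
    have "P * (Q * Z) = Z" if "Z \<in> carrier_mat m m" for Z
      using assoc[OF simD(6,7) that] that by (simp add: simD(1))
    then show ?thesis
      using X Y simD(6,7) by (simp add: assoc mult_carrier_mat[of _ m m _ m])
  qed
  have pow: "D ^\<^sub>m k = Q * B ^\<^sub>m k * P" for k
    using similar_mat_wit_pow_id[OF similar_mat_wit_sym[OF sim]] .
  have factor: "Q * A (t k) * P * D ^\<^sub>m e = Q * (A (t k) * B ^\<^sub>m e) * P" if "k \<le> m" for k e
    unfolding pow using conj[OF A[OF t[OF that]] pow_carrier_mat[OF B]] .
  have AB: "A (t k) * B ^\<^sub>m e \<in> carrier_mat m m" if "k \<le> m" for k e
    using A[OF t[OF that]] B by (auto intro!: mult_carrier_mat[of _ m m])
  have foldr_eq: "foldr (\<lambda>k M. Q * A (t k) * P * (D ^\<^sub>m s k) * M) ks (Q * N * P) =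
      Q * foldr (\<lambda>k M. A (t k) * (B ^\<^sub>m s k) * M) ks N * P"
    if "N \<in> carrier_mat m m" "set ks \<subseteq> {..m}" for ks N
    using that
  proof (induction ks)
    case (Cons k ks)
    have k: "k \<le> m" and IH: "foldr (\<lambda>k M. Q * A (t k) * P * (D ^\<^sub>m s k) * M) ks (Q * N * P) =
      Q * foldr (\<lambda>k M. A (t k) * (B ^\<^sub>m s k) * M) ks N * P"
      using Cons.prems Cons.IH by simp_all
    have tail: "foldr (\<lambda>k M. A (t k) * (B ^\<^sub>m s k) * M) ks N \<in> carrier_mat m m"
      using Cons.prems by (intro foldr_mult_carrier AB) auto
    show ?case
      unfolding foldr.simps o_apply IH unfolding factor[OF k] by (rule conj[OF AB[OF k] tail])
  qed simp
  show ?thesis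
    unfolding alternating_word_def factor[OF order_refl] by (rule foldr_eq) (auto intro: AB)
qed

text \<open>The trace does not see the outer conjugation. As the matrices A are arbitrary, the claim
  for D implies the claim for B.\<close>

lemma alternating_trace_sum_similar:
  assumes A: "\<And>i. i \<le> m \<Longrightarrow> A i \<in> carrier_mat m m" and B: "B \<in> carrier_mat m m"
    and sim: "similar_mat_wit B D P Q"
  shows "alternating_trace_sum m (\<lambda>i. Q * A i * P) D l = alternating_trace_sum m A B l"
  unfolding alternating_trace_sum_def
proof (intro sum.cong refl)
  fix s t assume "t \<in> cyclic_perms m"
  then have t: "t k \<le> m" if "k \<le> m" for k
    using permutes_in_image[OF cyclic_perms_permutes, of t m k] that by simp
  note simD = similar_mat_witD2[OF B sim]
  define W where "W = alternating_word m A B s t l"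
  have W: "W \<in> carrier_mat m m"
    unfolding W_def using A B t by (rule alternating_word_carrier)
  have "mat_trace (Q * W * P) = mat_trace (P * (Q * W))"
    by (rule mat_trace_mult_commute[of _ m]) (use W simD(6,7) in auto)
  also have "P * (Q * W) = (P * Q) * W"
    by (rule assoc_mult_mat[OF simD(6,7) W, symmetric])
  also have "\<dots> = W"
    using W by (simp add: simD(1))
  finally have "mat_trace (Q * W * P) = mat_trace W" .
  moreover have "alternating_word m (\<lambda>i. Q * A i * P) D s t l = Q * W * P"
    unfolding W_def by (rule alternating_word_similar[OF _ B _ sim]) (fact A, fact t)
  ultimately show "of_int (sign s) * of_int (sign t) *
      mat_trace (alternating_word m (\<lambda>i. Q * A i * P) D s t l) =
    of_int (sign s) * of_int (sign t) * mat_trace (alternating_word m A B s t l)"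
    by (simp only: W_def)
qed

lemma alternating_trace_sum_diagonalizable:
  fixes A :: "nat \<Rightarrow> 'a::{idom,ring_char_0} mat"
  assumes m: "m \<ge> 1" and A: "\<And>i. i \<le> m \<Longrightarrow> A i \<in> carrier_mat m m"
    and B: "B \<in> carrier_mat m m" and sim: "similar_mat B (mat_diag m x)"
  shows "alternating_trace_sum m A B l = 0"
proof -
  obtain P Q where wit: "similar_mat_wit B (mat_diag m x) P Q"
    using sim unfolding similar_mat_def by blast
  note simD = similar_mat_witD2[OF B wit]
  have "alternating_trace_sum m (\<lambda>i. Q * A i * P) (mat_diag m x) l = 0"
    by (rule alternating_trace_sum_diag[OF m], intro mult_carrier_mat[of _ m m] A simD)
  moreover have "alternating_trace_sum m (\<lambda>i. Q * A i * P) (mat_diag m x) l = alternating_trace_sum m A B l"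
    by (rule alternating_trace_sum_similar[OF _ B wit]) (fact A)
  ultimately show ?thesis by simp
qed

section \<open>Diagonalisation of triangular matrices with distinct diagonal\<close>

lemma jordan_matrix_trivial_blocks:
  assumes "\<And>na. na \<in> set n_as \<Longrightarrow> fst na = 1"
  shows "jordan_matrix n_as = mat_diag (length n_as) (\<lambda>i. snd (n_as ! i))"
  using assms
proof (induction n_as)
  case Nil
  show ?case by (rule eq_matI) (simp_all add: jordan_matrix_def mat_diag_def)
next
  case (Cons na n_as)
  obtain a where na: "na = (1, a)" using Cons.prems[of na] by (cases na) auto
  have len: "sum_list (map fst n_as) = length n_as" using Cons.prems by (induction n_as) auto
  show ?case
    unfolding na jordan_matrix_Cons len using Cons.IH Cons.prems
    by (intro eq_matI) (auto simp: mat_diag_def nth_Cons' less_Suc_eq_0_disj split: if_splits)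
qed

text \<open>A Jordan block is at most as large as the multiplicity of its eigenvalue in the
  characteristic polynomial. Here that polynomial is a product of distinct linear factors, so all
  blocks have size 1.\<close>

lemma similar_mat_diag_if_distinct:
  fixes T :: "'a::conjugatable_ordered_field mat"
  assumes T: "T \<in> carrier_mat n n" "upper_triangular T" and dist: "distinct (diag_mat T)"
  shows "\<exists>x. similar_mat T (mat_diag n x)"
proof -
  note cp = char_poly_upper_triangular[OF T]
  obtain n_as where jnf: "jordan_nf T n_as" using jordan_nf_exists[OF T(1) cp] ..
  have order_le: "order a (\<Prod>b\<leftarrow>bs. [:- b, 1:]) \<le> 1" if "distinct bs" for a :: 'a and bs
  proof -
    have "order a (\<Prod>b\<leftarrow>bs. [:- b, 1:]) = count_list bs a"
    proof (induction bs)
      case (Cons b bs)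
      have "order a [:- b, 1:] = (if a = b then 1 else 0)"
        using order_linear_power[of a "- b" 1] by simp
      moreover have "[:- b, 1:] * (\<Prod>b\<leftarrow>bs. [:- b, 1:]) \<noteq> 0"
        by (auto simp: prod_list_zero_iff simp del: mult_pCons_left)
      ultimately show ?case using Cons.IH by (simp add: order_mult del: mult_pCons_left)
    qed simp
    also have "\<dots> \<le> 1"
      using that by (induction bs) (auto simp: count_list_0_iff)
    finally show ?thesis .
  qed
  have blocks: "fst na = 1" if "na \<in> set n_as" for na
  proof -
    have "fst na \<le> 1"
      using jordan_nf_block_size_order_bound[OF jnf, of "fst na" "snd na"] that
        order_le[OF dist, of "snd na"] unfolding cp by simp
    \<comment> \<open>\<open>jordan_nf\<close> excludes empty blocks.\<close>
    moreover have "fst na \<noteq> 0" using jnf that by (force simp: jordan_nf_def)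
    ultimately show ?thesis by simp
  qed
  have sim: "similar_mat T (mat_diag (length n_as) (\<lambda>i. snd (n_as ! i)))"
    using jnf jordan_matrix_trivial_blocks[of n_as] blocks by (simp add: jordan_nf_def)
  \<comment> \<open>Similar matrices have equal size, which identifies the number of blocks with
    n.\<close>
  from similar_matD[OF sim] obtain k where
    "T \<in> carrier_mat k k" "mat_diag (length n_as) (\<lambda>i. snd (n_as ! i)) \<in> carrier_mat k k"
    by blast
  then have "length n_as = n"
    using T(1) by (metis carrier_matD(1) mat_diag_dim)
  with sim show ?thesis by blast
qed

section \<open>Continuity and the triangular case\<close>

text \<open>Entrywise convergence. The size is fixed for every e, not just eventually, so that
  entries of products unfold without a filter argument.\<close>

definition mat_tendsto ::
  "nat \<Rightarrow> ('b \<Rightarrow> 'a::real_normed_field mat) \<Rightarrow> 'a mat \<Rightarrow> 'b filter \<Rightarrow> bool" where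
  "mat_tendsto n X Y F \<longleftrightarrow> Y \<in> carrier_mat n n \<and> (\<forall>e. X e \<in> carrier_mat n n) \<and>
     (\<forall>i<n. \<forall>j<n. ((\<lambda>e. X e $$ (i, j)) \<longlongrightarrow> Y $$ (i, j)) F)"

lemma mat_tendsto_const: "X \<in> carrier_mat n n \<Longrightarrow> mat_tendsto n (\<lambda>_. X) X F"
  by (simp add: mat_tendsto_def)

lemma mat_tendsto_mult:
  fixes X :: "'b \<Rightarrow> 'a::real_normed_field mat"
  assumes X: "mat_tendsto n X X' F" and Y: "mat_tendsto n Y Y' F"
  shows "mat_tendsto n (\<lambda>e. X e * Y e) (X' * Y') F"
proof -
  have entry: "(U * V) $$ (i, j) = (\<Sum>k\<in>{0..<n}. U $$ (i, k) * V $$ (k, j))"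
    if "U \<in> carrier_mat n n" "V \<in> carrier_mat n n" "i < n" "j < n" for U V :: "'a mat" and i j
    using that by (auto simp: scalar_prod_def intro!: sum.cong)
  show ?thesis
    using X Y unfolding mat_tendsto_def
    by (auto simp: entry intro!: tendsto_sum tendsto_mult mult_carrier_mat[of _ n n])
qed

lemma mat_tendsto_pow:
  assumes "mat_tendsto n X X' F"
  shows "mat_tendsto n (\<lambda>e. X e ^\<^sub>m k) (X' ^\<^sub>m k) F"
proof (induction k)
  case 0
  have "dim_row (X e) = n" "dim_row X' = n" for e
    using assms by (auto simp: mat_tendsto_def)
  then show ?case by (simp add: mat_tendsto_const)
next
  case (Suc k)
  then show ?case using assms by (simp add: mat_tendsto_mult)
qed

text \<open>The sum is a polynomial in the entries of B, hence continuous in them.\<close>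

lemma tendsto_alternating_trace_sum:
  fixes A :: "nat \<Rightarrow> 'a::real_normed_field mat"
  assumes A: "\<And>i. i \<le> m \<Longrightarrow> A i \<in> carrier_mat m m" and B: "mat_tendsto m B B' F"
  shows "((\<lambda>e. alternating_trace_sum m A (B e) l) \<longlongrightarrow> alternating_trace_sum m A B' l) F"
  unfolding alternating_trace_sum_def
proof (intro tendsto_sum tendsto_mult tendsto_const)
  fix s t assume "t \<in> cyclic_perms m"
  then have t: "t k \<le> m" if "k \<le> m" for k
    using permutes_in_image[OF cyclic_perms_permutes, of t m k] that by simp
  have factor: "mat_tendsto m (\<lambda>e. A (t k) * B e ^\<^sub>m i) (A (t k) * B' ^\<^sub>m i) F" if "k \<le> m" for k i
    using A[OF t[OF that]] B by (intro mat_tendsto_mult mat_tendsto_const mat_tendsto_pow)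
  \<comment> \<open>Stated for any list of indices up to m in place of \<open>[0..<m]\<close>, so
    that induction on the list applies.\<close>
  have prefix: "mat_tendsto m (\<lambda>e. foldr (\<lambda>k M. A (t k) * (B e ^\<^sub>m s k) * M) ks (A (t m) * B e ^\<^sub>m l))
      (foldr (\<lambda>k M. A (t k) * (B' ^\<^sub>m s k) * M) ks (A (t m) * B' ^\<^sub>m l)) F"
    if "set ks \<subseteq> {..m}" for ks
    using that by (induction ks) (auto intro: mat_tendsto_mult factor)
  have "mat_tendsto m (\<lambda>e. alternating_word m A (B e) s t l) (alternating_word m A B' s t l) F"
    unfolding alternating_word_def by (rule prefix) auto
  moreover from this have "dim_row (alternating_word m A (B e) s t l) = m"
    "dim_row (alternating_word m A B' s t l) = m" for e
    by (auto simp: mat_tendsto_def)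
  ultimately show "((\<lambda>e. mat_trace (alternating_word m A (B e) s t l))
      \<longlongrightarrow> mat_trace (alternating_word m A B' s t l)) F"
    by (auto simp: mat_trace_def mat_tendsto_def intro!: tendsto_sum)
qed

text \<open>Adding e times diag(0, 1, ..., m - 1) keeps T triangular and separates its diagonal
  entries for all but finitely many e; the claim for T is the limit at e = 0.\<close>

lemma alternating_trace_sum_upper_triangular:
  fixes A :: "nat \<Rightarrow> complex mat"
  assumes m: "m \<ge> 1" and A: "\<And>i. i \<le> m \<Longrightarrow> A i \<in> carrier_mat m m"
    and T: "T \<in> carrier_mat m m" "upper_triangular T"
  shows "alternating_trace_sum m A T l = 0"
proof -
  \<comment> \<open>\<open>S\<close> is the finite set of \<open>e\<close> at which two diagonal entries of \<open>Te e\<close> can collide.\<close>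
  define Te where "Te = (\<lambda>e. mat m m (\<lambda>(i, j). T $$ (i, j) + (if i = j then e * of_nat i else 0)))"
  define S where "S = (\<lambda>(i, j). (T $$ (j, j) - T $$ (i, i)) / (of_nat i - of_nat j)) ` ({..<m} \<times> {..<m})"
  have Te: "Te e \<in> carrier_mat m m" "upper_triangular (Te e)" for e
    using T by (auto simp: Te_def upper_triangular_def)
  have zero: "alternating_trace_sum m A (Te e) l = 0" if "e \<notin> S" for e
  proof -
    have "inj_on (\<lambda>i. Te e $$ (i, i)) {..<m}"
    proof (rule inj_onI, rule ccontr)
      fix i j assume ij: "i \<in> {..<m}" "j \<in> {..<m}" "Te e $$ (i, i) = Te e $$ (j, j)" "i \<noteq> j"
      then have "e * (of_nat i - of_nat j) = T $$ (j, j) - T $$ (i, i)"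
        by (simp add: Te_def algebra_simps)
      then have "e = (T $$ (j, j) - T $$ (i, i)) / (of_nat i - of_nat j)"
        using ij by (simp add: field_simps)
      then show False using ij that by (auto simp: S_def)
    qed
    then have "distinct (diag_mat (Te e))"
      using Te(1)[of e] by (simp add: diag_mat_def distinct_map atLeast0LessThan)
    from similar_mat_diag_if_distinct[OF Te this] obtain x where sim: "similar_mat (Te e) (mat_diag m x)" ..
    show ?thesis by (rule alternating_trace_sum_diagonalizable[OF m _ Te(1) sim]) (rule A)
  qed
  have "((\<lambda>e. T $$ (i, j) + (if i = j then e * of_nat i else 0)) \<longlongrightarrow>
      T $$ (i, j)) (at 0)" for i j
    by (cases "i = j") (auto intro!: tendsto_eq_intros)
  then have Te_lim: "mat_tendsto m Te T (at 0)"
    using T(1) Te(1) by (auto simp: mat_tendsto_def Te_def)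
  have lim: "((\<lambda>e. alternating_trace_sum m A (Te e) l) \<longlongrightarrow> alternating_trace_sum m A T l) (at 0)"
    by (rule tendsto_alternating_trace_sum[OF _ Te_lim]) (rule A)
  \<comment> \<open>The pairs i = j put 0 into S, division by zero being 0. The punctured filter
    \<open>at 0\<close> ignores that point, and the finite rest of S is closed and misses 0.\<close>
  have "open (- (S - {0}))"
    by (intro open_Compl finite_imp_closed) (auto simp: S_def)
  then have "eventually (\<lambda>e. e \<in> - (S - {0})) (at 0)"
    by (rule eventually_at_in_open') simp
  then have "eventually (\<lambda>e. alternating_trace_sum m A (Te e) l = 0) (at 0)"
    using eventually_neq_at_within[of 0 0 UNIV] by eventually_elim (auto intro: zero)
  then have "((\<lambda>e. alternating_trace_sum m A (Te e) l) \<longlongrightarrow> 0) (at 0)"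
    by (rule tendsto_eventually)
  with lim show ?thesis by (rule tendsto_unique[rotated]) simp
qed

section \<open>The general case by triangularisation\<close>

theorem theorem4p5:
  fixes m l :: nat
    and A :: "nat \<Rightarrow> complex mat"
    and B :: "complex mat"
  assumes "m \<ge> 1"
    and "\<And>i. i \<le> m \<Longrightarrow> A i \<in> carrier_mat m m"
    and "B \<in> carrier_mat m m"
  shows "(\<Sum>\<sigma> | \<sigma> permutes {0..<m}. \<Sum>\<tau>\<in>cyclic_perms m.
           of_int (sign \<sigma>) * of_int (sign \<tau>) * mat_trace (alternating_word m A B \<sigma> \<tau> l)) = 0"
proof -
  \<comment> \<open>Over the complex numbers the characteristic polynomial splits, which is what
    Schur triangularisation asks for.\<close>
  obtain as where "char_poly B = (\<Prod>a\<leftarrow>as. [:- a, 1:])"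
    using char_poly_factorized[OF assms(3)] by blast
  from schur_decomposition_exists[OF assms(3) this] obtain T P Q
    where T: "T \<in> carrier_mat m m" "upper_triangular T" and wit: "similar_mat_wit B T P Q"
    by (auto simp: similar_mat_def)
  note simD = similar_mat_witD2[OF assms(3) wit]
  have "alternating_trace_sum m (\<lambda>i. Q * A i * P) T l = 0"
    by (rule alternating_trace_sum_upper_triangular[OF assms(1) _ T], intro mult_carrier_mat[of _ m m] assms(2) simD)
  moreover have "alternating_trace_sum m (\<lambda>i. Q * A i * P) T l = alternating_trace_sum m A B l"
    by (rule alternating_trace_sum_similar[OF _ assms(3) wit]) (fact assms(2))
  ultimately show ?thesis by (simp add: alternating_trace_sum_def)
qed

end
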